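(* For every integer $m\geq 3$, the maximal absolute projection constant of real $m$-dimensional Banach spaces satisfies $$\lambda_{\mathbb{R}}(m)\geq \frac{4(m-2)}{m+1}.$$
   Context: All Banach spaces here are over $\mathbb{R}$. For a Banach space $X$ and a subspace $Y\subset X$, let $\mathcal{P}(X,Y)$ be the set of continuous linear projections of $X$ onto $Y$, i.e. continuous linear maps $P:X\to Y$ with $P|_Y=\mathrm{Id}_Y$. The relative projection constant is $\lambda(Y,X)=\inf\{\|P\|: P\in\mathcal{P}(X,Y)\}$ (with value $\infty$ if $\mathcal{P}(X,Y)$ is empty). The absolute projection constant of a Banach space $Y$ is $\lambda(Y)=\sup\{\lambda(Y,X): Y\subset X\}$, the supremum being over all Banach spaces $X$ containing $Y$ as a subspace (with the norm of $X$ restricting to that of $Y$). The maximal absolute projection constant is $$\lambda_{\mathbb{R}}(m)=\sup\{\lambda(Y): Y \text{ a real Banach space},\ \dim(Y)=m\}.$$ Known facts used by the paper as background: $\lambda_{\mathbb{R}}(m)=\sup_{N\ge m}\lambda_{\mathbb{R}}(m,N)$, where $\lambda_{\mathbb{R}}(m,N)=\sup\{\lambda(Y,\ell_\infty^{(N)}(\mathbb{R})): Y\subset \ell_\infty^{(N)}(\mathbb{R}),\ \dim(Y)=m\}$, and (Chalmers–Lewicki) for integers $N\ge m$, $$\lambda_{\mathbb{R}}(m,N)=\max\Big\{\sum_{i,j=1}^N t_it_j\,|(U^{*}U)_{ij}| : t\in\mathbb{R}_+^N,\ \|t\|_2=1,\ U\in\mathbb{R}^{m\times N},\ UU^{*}=\mathrm{I}_m\Big\},$$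 where $\mathbb{R}_+^N$ denotes the set of vectors with nonnegative real coordinates. *)

theory Defs
  imports Complex_Main "HOL-Library.Extended_Real"
begin

text \<open>
  HOL cannot quantify over all Banach spaces inside a formula, so Banach spaces are modelled inside
  an arbitrary real vector space \<open>'u\<close> acting as a universe: a Banach space is a pair \<open>(X, N)\<close> of a
  linear subspace \<open>X\<close> of \<open>'u\<close> and a complete norm \<open>N\<close> on \<open>X\<close>. The norm \<open>N\<close> is unrelated to any
  norm or topology \<open>'u\<close> may carry, and its values outside \<open>X\<close> are irrelevant. If \<open>'u\<close> is
  infinite-dimensional and \<open>Y\<close> is a finite-dimensional subspace, then every Banach space containing
  \<open>(Y, M)\<close> whose Hamel dimension is at most that of \<open>'u\<close> occurs, up to an isometric isomorphism
  fixing \<open>Y\<close>, as such a pair. In particular, if the Hamel dimension of \<open>'u\<close> is at least the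
  continuum, the spaces containing \<open>Y\<close> include a copy of \<open>\<ell>\<^sub>\<infinity>\<close>, whose injectivity implies that no
  larger space increases the supremum defining the absolute projection constant. For smaller
  infinite-dimensional \<open>'u\<close> the value is the same, since by a compactness argument finite-dimensional
  superspaces of \<open>Y\<close> suffice.
\<close>

definition norm_on :: "'u::real_vector set \<Rightarrow> ('u \<Rightarrow> real) \<Rightarrow> bool" where
  "norm_on X N \<longleftrightarrow>
     (\<forall>x\<in>X. 0 \<le> N x \<and> (N x = 0 \<longleftrightarrow> x = 0)) \<and>
     (\<forall>x\<in>X. \<forall>y\<in>X. N (x + y) \<le> N x + N y) \<and>
     (\<forall>c. \<forall>x\<in>X. N (c *\<^sub>R x) = \<bar>c\<bar> * N x)"

definition complete_on :: "'u::real_vector set \<Rightarrow> ('u \<Rightarrow> real) \<Rightarrow> bool" where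
  "complete_on X N \<longleftrightarrow>
     (\<forall>s :: nat \<Rightarrow> 'u. (\<forall>n. s n \<in> X) \<longrightarrow>
        (\<forall>e>0. \<exists>k. \<forall>i\<ge>k. \<forall>j\<ge>k. N (s i - s j) < e) \<longrightarrow>
        (\<exists>l\<in>X. (\<lambda>n. N (s n - l)) \<longlonglongrightarrow> 0))"

definition banach_on :: "'u::real_vector set \<Rightarrow> ('u \<Rightarrow> real) \<Rightarrow> bool" where
  "banach_on X N \<longleftrightarrow> subspace X \<and> norm_on X N \<and> complete_on X N"

definition bounded_linear_on :: "'u::real_vector set \<Rightarrow> ('u \<Rightarrow> real) \<Rightarrow> ('u \<Rightarrow> 'u) \<Rightarrow> bool" where
  "bounded_linear_on X N P \<longleftrightarrow>
     (\<forall>x\<in>X. \<forall>y\<in>X. P (x + y) = P x + P y) \<and>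
     (\<forall>c. \<forall>x\<in>X. P (c *\<^sub>R x) = c *\<^sub>R P x) \<and>
     (\<exists>K. \<forall>x\<in>X. N (P x) \<le> K * N x)"

definition projections_onto ::
    "'u::real_vector set \<Rightarrow> ('u \<Rightarrow> real) \<Rightarrow> 'u set \<Rightarrow> ('u \<Rightarrow> 'u) set" where
  "projections_onto X N Y = {P. bounded_linear_on X N P \<and> P ` X \<subseteq> Y \<and> (\<forall>y\<in>Y. P y = y)}"

text \<open>The same formula as the library's \<open>onorm\<close>; the quotient at \<open>x = 0\<close> is \<open>0\<close>.\<close>

definition onorm_on :: "'u::real_vector set \<Rightarrow> ('u \<Rightarrow> real) \<Rightarrow> ('u \<Rightarrow> 'u) \<Rightarrow> real" where
  "onorm_on X N P = (SUP x\<in>X. N (P x) / N x)"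

text \<open>The infimum over the empty set is \<open>\<infinity>\<close> in type \<^typ>\<open>ereal\<close>.\<close>

definition rel_proj_const :: "'u::real_vector set \<Rightarrow> 'u set \<Rightarrow> ('u \<Rightarrow> real) \<Rightarrow> ereal" where
  "rel_proj_const Y X N = (INF P\<in>projections_onto X N Y. ereal (onorm_on X N P))"

definition abs_proj_const :: "'u::real_vector set \<Rightarrow> ('u \<Rightarrow> real) \<Rightarrow> ereal" where
  "abs_proj_const Y M =
     (SUP (X, N)\<in>{(X, N). banach_on X N \<and> Y \<subseteq> X \<and> (\<forall>y\<in>Y. N y = M y)}. rel_proj_const Y X N)"

text \<open>
  The finiteness condition only matters for \<open>m = 0\<close>, because \<open>dim\<close> assigns \<open>0\<close> to
  infinite-dimensional subspaces.
\<close>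

definition max_abs_proj_const :: "'u::real_vector itself \<Rightarrow> nat \<Rightarrow> ereal" where
  "max_abs_proj_const _ m =
     (SUP (Y, M)\<in>{(Y :: 'u set, M). banach_on Y M \<and> (\<exists>B. finite B \<and> span B = Y) \<and> dim Y = m}.
        abs_proj_const Y M)"

end

theory Submission
  imports Defs
begin

text \<open>
  Let \<open>n = m + 1\<close> and let \<open>Y\<close> be the space of edge weights \<open>{i, j} \<mapsto> a i + a j\<close> of the complete graph
  on \<open>n\<close> vertices, \<open>a\<close> ranging over the vectors with sum zero, inside \<open>\<ell>\<^sub>\<infinity>\<close> of the \<open>N\<close> edges. With
  \<open>K e f = card (e \<inter> f)\<close>, \<open>Y\<close> is the eigenspace of \<open>K\<close> for the eigenvalue \<open>n - 2\<close>. The sign matrix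
  \<open>S\<close> with \<open>S e f = -1\<close> for disjoint edges and \<open>1\<close> otherwise equals \<open>2 K - J - 2 I\<close>, where \<open>J\<close> has all
  entries \<open>1\<close>; so it acts on \<open>Y\<close> as the scalar \<open>2 n - 6\<close>. For a projection \<open>P\<close> onto \<open>Y\<close> hence
  \<open>tr (S P) = (2 n - 6) tr P = (2 n - 6) (n - 1)\<close>, while \<open>tr (S P)\<close> is at most the sum of the absolute
  values of the entries of \<open>P\<close>, which is at most \<open>N \<parallel>P\<parallel>\<close>. Dividing by \<open>N = n (n - 1) / 2\<close> gives
  \<open>\<parallel>P\<parallel> \<ge> 4 (n - 3) / n\<close>.
\<close>

section \<open>Supremum norms given by coordinate functionals\<close>

locale biorthogonal =
  fixes I :: "'i set" and b :: "'i \<Rightarrow> 'u::real_vector" and c :: "'i \<Rightarrow> 'u \<Rightarrow> real"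
  assumes finite_I: "finite I" and I_nonempty: "I \<noteq> {}"
    and linear_c: "i \<in> I \<Longrightarrow> linear (c i)"
    and c_b: "i \<in> I \<Longrightarrow> j \<in> I \<Longrightarrow> c i (b j) = (if i = j then 1 else 0)"
begin

definition vec :: "('i \<Rightarrow> real) \<Rightarrow> 'u" where
  "vec v = (\<Sum>i\<in>I. v i *\<^sub>R b i)"

definition sup_norm :: "'u \<Rightarrow> real" where
  "sup_norm x = Max ((\<lambda>i. \<bar>c i x\<bar>) ` I)"

text \<open>Subspaces are cut out by linear equations in the coordinates because such equations
  survive limits; \<open>A = 0\<close> gives the whole span.\<close>

definition eqn_space :: "('i \<Rightarrow> 'i \<Rightarrow> real) \<Rightarrow> 'u set" where
  "eqn_space A = {x \<in> span (b ` I). \<forall>k\<in>I. (\<Sum>j\<in>I. A k j * c j x) = 0}"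

lemmas c_simps = linear_add[OF linear_c] linear_diff[OF linear_c] linear_cmul[OF linear_c]
  linear_0[OF linear_c] linear_sum[OF linear_c]

lemma c_vec: "i \<in> I \<Longrightarrow> c i (vec v) = v i"
  by (simp add: vec_def c_simps c_b finite_I if_distrib[of "\<lambda>x. _ * x"] sum.delta cong: if_cong)

lemma vec_in_span: "vec v \<in> span (b ` I)"
  unfolding vec_def by (intro span_sum span_scale span_base) auto

lemma span_eq_vec:
  assumes "x \<in> span (b ` I)"
  shows "x = vec (\<lambda>i. c i x)"
  using assms
proof (induction rule: span_induct_alt)
  case base
  then show ?case by (simp add: vec_def c_simps)
next
  case (step r x y)
  then obtain j where j: "j \<in> I" "x = b j" by auto
  have "b j = (\<Sum>i\<in>I. (if i = j then 1 else 0) *\<^sub>R b i)"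
    using j finite_I by (simp add: if_distrib[of "\<lambda>r. r *\<^sub>R _"] sum.delta cong: if_cong)
  also have "\<dots> = vec (\<lambda>i. c i x)"
    unfolding vec_def using j by (intro sum.cong) (auto simp: c_b)
  finally have x: "x = vec (\<lambda>i. c i x)" using j by simp
  have "vec (\<lambda>i. c i (r *\<^sub>R x + y)) = (\<Sum>i\<in>I. r *\<^sub>R (c i x *\<^sub>R b i) + c i y *\<^sub>R b i)"
    unfolding vec_def by (intro sum.cong) (auto simp: c_simps algebra_simps)
  also have "\<dots> = r *\<^sub>R vec (\<lambda>i. c i x) + vec (\<lambda>i. c i y)"
    by (simp add: vec_def sum.distrib scaleR_sum_right)
  finally show ?case using x step by simp
qed

lemma span_eqI:
  assumes "x \<in> span (b ` I)" "y \<in> span (b ` I)" "\<And>i. i \<in> I \<Longrightarrow> c i x = c i y"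
  shows "x = y"
proof -
  have "x = vec (\<lambda>i. c i x)" using assms by (intro span_eq_vec)
  also have "\<dots> = vec (\<lambda>i. c i y)" using assms(3) by (simp add: vec_def)
  also have "\<dots> = y" using assms by (intro span_eq_vec[symmetric])
  finally show ?thesis .
qed

lemma c_le_sup_norm: "i \<in> I \<Longrightarrow> \<bar>c i x\<bar> \<le> sup_norm x"
  unfolding sup_norm_def using finite_I by simp

lemma sup_norm_leI: "(\<And>i. i \<in> I \<Longrightarrow> \<bar>c i x\<bar> \<le> r) \<Longrightarrow> sup_norm x \<le> r"
  unfolding sup_norm_def using finite_I I_nonempty by simp

lemma sup_norm_nonneg: "0 \<le> sup_norm x"
  using I_nonempty c_le_sup_norm abs_ge_zero order_trans by (metis ex_in_conv)

lemma norm_on_sup_norm: "norm_on (span (b ` I)) sup_norm"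
  unfolding norm_on_def
proof (intro conjI ballI allI)
  fix x y assume x: "x \<in> span (b ` I)"
  show "0 \<le> sup_norm x" by (rule sup_norm_nonneg)
  show "sup_norm x = 0 \<longleftrightarrow> x = 0"
  proof
    assume "sup_norm x = 0"
    then have "c i x = 0" if "i \<in> I" for i
      using c_le_sup_norm[OF that, of x] by simp
    then show "x = 0" using x by (intro span_eqI) (auto simp: c_simps span_zero)
  next
    assume "x = 0"
    then show "sup_norm x = 0"
      by (intro antisym sup_norm_nonneg sup_norm_leI) (simp add: c_simps)
  qed
  show "sup_norm (x + y) \<le> sup_norm x + sup_norm y"
  proof (rule sup_norm_leI)
    fix i assume "i \<in> I"
    then show "\<bar>c i (x + y)\<bar> \<le> sup_norm x + sup_norm y"
      using c_le_sup_norm[of i x] c_le_sup_norm[of i y] by (simp add: c_simps)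
  qed
next
  fix r x assume "x \<in> span (b ` I)"
  have le: "sup_norm (r *\<^sub>R x) \<le> \<bar>r\<bar> * sup_norm x" for r x
    by (rule sup_norm_leI) (simp add: c_simps abs_mult c_le_sup_norm mult_left_mono)
  show "sup_norm (r *\<^sub>R x) = \<bar>r\<bar> * sup_norm x"
  proof (cases "r = 0")
    case True
    then show ?thesis using le[of r x] sup_norm_nonneg[of "r *\<^sub>R x"] by simp
  next
    case False
    then have "\<bar>r\<bar> * sup_norm x \<le> sup_norm (r *\<^sub>R x)"
      using le[of "inverse r" "r *\<^sub>R x"] by (simp add: field_simps)
    then show ?thesis using le[of r x] by simp
  qed
qed

lemma subspace_eqn_space: "subspace (eqn_space A)"
proof (rule subspaceI)
  show "0 \<in> eqn_space A" by (simp add: eqn_space_def span_zero c_simps)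
next
  fix x y assume "x \<in> eqn_space A" "y \<in> eqn_space A"
  then show "x + y \<in> eqn_space A"
    by (simp add: eqn_space_def span_add c_simps distrib_left sum.distrib)
next
  fix r x assume x: "x \<in> eqn_space A"
  have "(\<Sum>j\<in>I. A k j * c j (r *\<^sub>R x)) = r * (\<Sum>j\<in>I. A k j * c j x)" for k
    by (simp add: c_simps sum_distrib_left algebra_simps)
  then show "r *\<^sub>R x \<in> eqn_space A" using x by (simp add: eqn_space_def span_scale)
qed

text \<open>Each coordinate of a Cauchy sequence converges, and the limits inherit the equations.
  The sum of the finitely many coordinate errors dominates their maximum, which gives convergence in
  norm.\<close>

lemma complete_on_eqn_space: "complete_on (eqn_space A) sup_norm"
  unfolding complete_on_def
proof (intro allI impI)
  fix s :: "nat \<Rightarrow> 'u"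
  assume s: "\<forall>n. s n \<in> eqn_space A"
    and Cauchy: "\<forall>e>0. \<exists>k. \<forall>i\<ge>k. \<forall>j\<ge>k. sup_norm (s i - s j) < e"
  have "\<exists>l. (\<lambda>n. c i (s n)) \<longlonglongrightarrow> l" if i: "i \<in> I" for i
  proof -
    have "Cauchy (\<lambda>n. c i (s n))"
    proof (rule metric_CauchyI)
      fix e :: real assume "0 < e"
      then obtain k where k: "\<forall>p\<ge>k. \<forall>q\<ge>k. sup_norm (s p - s q) < e" using Cauchy by blast
      have "dist (c i (s p)) (c i (s q)) < e" if "p \<ge> k" "q \<ge> k" for p q
        using k that c_le_sup_norm[OF i, of "s p - s q"]
        by (force simp: dist_real_def c_simps(2)[OF i, symmetric])
      then show "\<exists>M. \<forall>m\<ge>M. \<forall>n\<ge>M. dist (c i (s m)) (c i (s n)) < e" by blast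
    qed
    then show ?thesis using Cauchy_convergent_iff convergent_def by blast
  qed
  then obtain l where l: "\<And>i. i \<in> I \<Longrightarrow> (\<lambda>n. c i (s n)) \<longlonglongrightarrow> l i" by metis
  have "(\<Sum>j\<in>I. A k j * l j) = 0" if "k \<in> I" for k
  proof (rule LIMSEQ_unique)
    show "(\<lambda>n. \<Sum>j\<in>I. A k j * c j (s n)) \<longlonglongrightarrow> (\<Sum>j\<in>I. A k j * l j)"
      by (intro tendsto_sum tendsto_mult_left l)
    show "(\<lambda>n. \<Sum>j\<in>I. A k j * c j (s n)) \<longlonglongrightarrow> 0"
      using s that by (simp add: eqn_space_def)
  qed
  then have mem: "vec l \<in> eqn_space A" by (simp add: eqn_space_def vec_in_span c_vec)
  have "(\<lambda>n. \<Sum>i\<in>I. \<bar>c i (s n) - l i\<bar>) \<longlonglongrightarrow> (\<Sum>i\<in>I. \<bar>l i - l i\<bar>)"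
    by (intro tendsto_intros l)
  then have lim: "(\<lambda>n. \<Sum>i\<in>I. \<bar>c i (s n) - l i\<bar>) \<longlonglongrightarrow> 0" by simp
  have "sup_norm (s n - vec l) \<le> (\<Sum>i\<in>I. \<bar>c i (s n) - l i\<bar>)" for n
  proof (rule sup_norm_leI)
    fix i assume i: "i \<in> I"
    then show "\<bar>c i (s n - vec l)\<bar> \<le> (\<Sum>i\<in>I. \<bar>c i (s n) - l i\<bar>)"
      using member_le_sum[of i I "\<lambda>i. \<bar>c i (s n) - l i\<bar>"] finite_I by (simp add: c_simps c_vec)
  qed
  then have "(\<lambda>n. sup_norm (s n - vec l)) \<longlonglongrightarrow> 0"
    by (intro tendsto_sandwich[OF _ _ tendsto_const lim]) (auto simp: sup_norm_nonneg)
  with mem show "\<exists>l\<in>eqn_space A. (\<lambda>n. sup_norm (s n - l)) \<longlonglongrightarrow> 0" by blast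
qed

lemma banach_on_eqn_space: "banach_on (eqn_space A) sup_norm"
proof -
  have "norm_on (eqn_space A) sup_norm"
    using norm_on_sup_norm unfolding norm_on_def eqn_space_def by blast
  then show ?thesis
    unfolding banach_on_def using subspace_eqn_space complete_on_eqn_space by blast
qed

lemma banach_on_span: "banach_on (span (b ` I)) sup_norm"
  using banach_on_eqn_space[of "\<lambda>_ _. 0"] by (simp add: eqn_space_def)

lemma bounded_linear_on_vec:
  assumes "bounded_linear_on (span (b ` I)) N P"
  shows "P (vec v) = (\<Sum>i\<in>I. v i *\<^sub>R P (b i))"
proof -
  let ?X = "span (b ` I)"
  have add: "P (x + y) = P x + P y" if "x \<in> ?X" "y \<in> ?X" for x y
    using assms that by (simp add: bounded_linear_on_def)
  have scale: "P (r *\<^sub>R x) = r *\<^sub>R P x" if "x \<in> ?X" for r x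
    using assms that by (simp add: bounded_linear_on_def)
  have "J \<subseteq> I \<Longrightarrow> P (\<Sum>i\<in>J. v i *\<^sub>R b i) = (\<Sum>i\<in>J. v i *\<^sub>R P (b i))" if "finite J" for J
    using that
  proof (induction J rule: finite_induct)
    case empty
    then show ?case using scale[OF span_zero, of 0] by simp
  next
    case (insert i J)
    then have "(\<Sum>i\<in>J. v i *\<^sub>R b i) \<in> ?X" "b i \<in> ?X"
      by (intro span_sum span_scale span_base; auto)+
    then show ?case using insert by (simp add: add scale span_scale)
  qed
  then show ?thesis unfolding vec_def using finite_I by simp
qed

text \<open>Taking for \<open>S\<close> the sign pattern of \<open>P\<close> turns the left-hand side into the sum of the absolute values of
  all matrix entries of \<open>P\<close>, which the norm bounds row by row.\<close>

lemma trace_le_onorm: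
  assumes P: "bounded_linear_on (span (b ` I)) sup_norm P"
    and S: "\<And>i j. i \<in> I \<Longrightarrow> j \<in> I \<Longrightarrow> \<bar>S i j\<bar> \<le> 1"
  shows "(\<Sum>j\<in>I. \<Sum>i\<in>I. S i j * c j (P (b i))) \<le> card I * onorm_on (span (b ` I)) sup_norm P"
proof -
  let ?X = "span (b ` I)" and ?L = "onorm_on (span (b ` I)) sup_norm P"
  obtain K where K: "\<And>x. x \<in> ?X \<Longrightarrow> sup_norm (P x) \<le> K * sup_norm x"
    using P unfolding bounded_linear_on_def by blast
  \<comment> \<open>A real \<open>SUP\<close> bounds its family only if the family is bounded above.
    The maximum with 0 covers the quotient 0 at vectors of norm zero and a possibly negative
    \<open>K\<close>.\<close>
  have ratio: "sup_norm (P x) / sup_norm x \<le> max K 0" if "x \<in> ?X" for x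
  proof (cases "sup_norm x = 0")
    case False
    then have "sup_norm (P x) / sup_norm x \<le> K"
      using K[OF that] sup_norm_nonneg[of x] by (simp add: divide_le_eq)
    then show ?thesis by simp
  qed simp
  have L: "sup_norm (P x) / sup_norm x \<le> ?L" if "x \<in> ?X" for x
    unfolding onorm_on_def using ratio that by (intro cSUP_upper) (auto intro!: bdd_aboveI2)
  have L0: "0 \<le> ?L"
    by (rule order_trans[OF _ L[OF span_zero]]) (simp add: sup_norm_nonneg)
  have "(\<Sum>i\<in>I. S i j * c j (P (b i))) \<le> ?L" if j: "j \<in> I" for j
  proof -
    let ?x = "vec (\<lambda>i. S i j)"
    have "(\<Sum>i\<in>I. S i j * c j (P (b i))) = c j (P ?x)"
      using j by (simp add: bounded_linear_on_vec[OF P] c_simps)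
    also have "\<dots> \<le> sup_norm (P ?x)" using c_le_sup_norm[OF j, of "P ?x"] by simp
    \<comment> \<open>If the test vector has norm zero, the quotient says nothing, but the bound by
      \<open>K\<close> forces its image to have norm zero.\<close>
    also have "\<dots> \<le> ?L * sup_norm ?x"
      using L[OF vec_in_span] K[OF vec_in_span, of "\<lambda>i. S i j"] sup_norm_nonneg[of ?x]
      by (cases "sup_norm ?x = 0") (auto simp: divide_le_eq)
    also have "\<dots> \<le> ?L * 1"
      using S j by (intro mult_left_mono L0 sup_norm_leI) (simp add: c_vec)
    finally show ?thesis by simp
  qed
  from sum_mono[OF this] show ?thesis by simp
qed

end

text \<open>Dual functionals on finitely many independent vectors extend linearly to the whole
  universe.\<close>

lemma exists_biorthogonal:
  fixes B :: "'u::real_vector set"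
  assumes B: "infinite B" "independent B" and I: "finite I" "I \<noteq> {}"
  shows "\<exists>(b :: 'i \<Rightarrow> 'u) c. biorthogonal I b c"
proof -
  obtain C where C: "C \<subseteq> B" "finite C" "card C = card I"
    using infinite_arbitrarily_large[OF B(1)] by metis
  then obtain b where b: "bij_betw b I C" using I finite_same_card_bij by metis
  have "independent C" using B(2) C(1) independent_mono by blast
  then have "\<exists>g :: 'u \<Rightarrow> real. linear g \<and> (\<forall>x\<in>C. g x = (if x = b i then 1 else 0))" for i
    by (rule linear_independent_extend)
  then obtain c where c: "\<And>i. linear (c i)"
    "\<And>i x. x \<in> C \<Longrightarrow> c i x = (if x = b i then 1 else 0 :: real)"
    by metis
  have "biorthogonal I b c"
  proof (rule biorthogonal.intro)
    fix i j assume "i \<in> I" "j \<in> I"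
    then show "c i (b j) = (if i = j then 1 else 0)"
      using b c(2)[of "b j" i] by (auto simp: bij_betw_def inj_on_def)
  qed (use I c(1) in auto)
  then show ?thesis by blast
qed

text \<open>The functional \<open>\<phi> k\<close> kills the span of the other vectors but not
  \<open>y k\<close>.\<close>

lemma dual_family_independent:
  fixes y :: "'k \<Rightarrow> 'u::real_vector" and \<phi> :: "'k \<Rightarrow> 'u \<Rightarrow> real"
  assumes lin: "\<And>k. k \<in> K \<Longrightarrow> linear (\<phi> k)"
    and dual: "\<And>k j. k \<in> K \<Longrightarrow> j \<in> K \<Longrightarrow> \<phi> k (y j) = (if k = j then 1 else 0)"
  shows "inj_on y K" "independent (y ` K)"
proof -
  show inj: "inj_on y K"
  proof (rule inj_onI)
    fix i j assume "i \<in> K" "j \<in> K" "y i = y j"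
    then show "i = j" using dual[of i i] dual[of i j] by (auto split: if_splits)
  qed
  show "independent (y ` K)"
    unfolding dependent_def
  proof (clarify)
    fix k assume k: "k \<in> K" and mem: "y k \<in> span (y ` K - {y k})"
    have "\<phi> k x = 0" if "x \<in> y ` K - {y k}" for x
      using that dual[OF k] by auto
    then have "\<phi> k (y k) = 0"
      using linear_eq_0_on_span[OF lin[OF k] _ mem] by blast
    then show False using dual[OF k k] by simp
  qed
qed

section \<open>Edge weights of the complete graph\<close>

definition edges :: "nat \<Rightarrow> nat set set" where
  "edges n = {e. e \<subseteq> {..<n} \<and> card e = 2}"

lemma finite_edges: "finite (edges n)"
  unfolding edges_def by simp

lemma edges_nonempty: "n \<ge> 2 \<Longrightarrow> edges n \<noteq> {}"
  unfolding edges_def by (auto intro!: exI[of _ "{0, 1}"])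

lemma finite_edge: "e \<in> edges n \<Longrightarrow> finite e"
  unfolding edges_def by (auto intro: finite_subset)

text \<open>The edges at \<open>i\<close> join it to the \<open>n - 1\<close> other vertices:
  \<open>a i\<close> occurs \<open>n - 1\<close> times, and the other ends contribute the total
  minus \<open>a i\<close>.\<close>

lemma sum_incident_edges:
  fixes a :: "nat \<Rightarrow> real"
  assumes i: "i < n"
  shows "(\<Sum>f\<in>{f \<in> edges n. i \<in> f}. \<Sum>j\<in>f. a j) = (real n - 2) * a i + (\<Sum>j<n. a j)"
proof -
  have "{f \<in> edges n. i \<in> f} = (\<lambda>j. {i, j}) ` ({..<n} - {i})"
    using i by (auto simp: edges_def card_2_iff)
  moreover have "inj_on (\<lambda>j. {i, j}) ({..<n} - {i})"
    by (auto simp: inj_on_def doubleton_eq_iff)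
  ultimately have "(\<Sum>f\<in>{f \<in> edges n. i \<in> f}. \<Sum>j\<in>f. a j)
      = (\<Sum>j\<in>{..<n} - {i}. \<Sum>j\<in>{i, j}. a j)"
    by (simp add: sum.reindex)
  also have "\<dots> = (\<Sum>j\<in>{..<n} - {i}. a i + a j)"
    by (intro sum.cong) auto
  also have "\<dots> = (real n - 2) * a i + (\<Sum>j<n. a j)"
    using i by (simp add: sum.distrib sum_diff1 algebra_simps of_nat_diff)
  finally show ?thesis .
qed

text \<open>Counting common vertices one at a time factors \<open>K\<close> as the transposed
  incidence matrix times the incidence matrix.\<close>

lemma sum_card_Int_edges:
  fixes v :: "nat set \<Rightarrow> real"
  assumes e: "e \<in> edges n"
  shows "(\<Sum>f\<in>edges n. real (card (e \<inter> f)) * v f) = (\<Sum>i\<in>e. \<Sum>f\<in>{f \<in> edges n. i \<in> f}. v f)"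
proof -
  have "real (card (e \<inter> f)) * v f = (\<Sum>i\<in>e. if i \<in> f then v f else 0)" for f
    using finite_edge[OF e] by (simp add: sum.If_cases Int_def)
  then have "(\<Sum>f\<in>edges n. real (card (e \<inter> f)) * v f)
      = (\<Sum>i\<in>e. \<Sum>f\<in>edges n. if i \<in> f then v f else 0)"
    by (simp add: sum.swap[of _ e])
  also have "\<dots> = (\<Sum>i\<in>e. \<Sum>f\<in>{f \<in> edges n. i \<in> f}. v f)"
    by (intro sum.cong refl sum.inter_filter[symmetric] finite_edges)
  finally show ?thesis .
qed

text \<open>For \<open>a\<close> of sum zero the edge weights are eigenvectors of \<open>K\<close>
  with eigenvalue \<open>n - 2\<close>; for constant \<open>a\<close> the eigenvalue is
  \<open>2 n - 2\<close>.\<close>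

lemma sum_card_Int_edge_weights:
  fixes a :: "nat \<Rightarrow> real"
  assumes e: "e \<in> edges n"
  shows "(\<Sum>f\<in>edges n. real (card (e \<inter> f)) * (\<Sum>j\<in>f. a j))
    = (real n - 2) * (\<Sum>j\<in>e. a j) + 2 * (\<Sum>j<n. a j)"
proof -
  have "e \<subseteq> {..<n}" "card e = 2" using e by (auto simp: edges_def)
  then have "(\<Sum>i\<in>e. \<Sum>f\<in>{f \<in> edges n. i \<in> f}. \<Sum>j\<in>f. a j)
      = (\<Sum>i\<in>e. (real n - 2) * a i + (\<Sum>j<n. a j))"
    by (intro sum.cong refl sum_incident_edges) auto
  also have "\<dots> = (real n - 2) * (\<Sum>j\<in>e. a j) + 2 * (\<Sum>j<n. a j)"
    using \<open>card e = 2\<close> by (simp add: sum.distrib sum_distrib_left)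
  finally show ?thesis using sum_card_Int_edges[OF e] by simp
qed

lemma sum_card_Int_const:
  assumes e: "e \<in> edges n"
  shows "(\<Sum>f\<in>edges n. real (card (e \<inter> f))) = 2 * real n - 2"
proof -
  \<comment> \<open>Weight 1/2 at every vertex gives every edge weight 1.\<close>
  have "(\<Sum>f\<in>edges n. real (card (e \<inter> f)) * (\<Sum>j\<in>f. 1/2)) = 2 * real n - 2"
    using e sum_card_Int_edge_weights[OF e, of "\<lambda>_. 1/2"] by (simp add: edges_def)
  moreover have "(\<Sum>j\<in>f. 1/2 :: real) = 1" if "f \<in> edges n" for f
    using that by (simp add: edges_def)
  ultimately show ?thesis by simp
qed

section \<open>The eigenspace \<open>Y\<close>, its vertex weights and its dimension\<close>

locale edge_space = biorthogonal "edges n" b c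
  for n and b :: "nat set \<Rightarrow> 'u::real_vector" and c +
  assumes n_ge: "n \<ge> 4"
begin

text \<open>Taking the eigenspace as the definition makes completeness immediate; the description by
  vertex weights is recovered in \<open>c_eq_sum_vertex\<close> and
  \<open>sum_vertex_eq_0\<close>.\<close>

definition Y :: "'u set" where
  "Y = eqn_space (\<lambda>e f. real (card (e \<inter> f)) - (if e = f then real n - 2 else 0))"

definition weight_vec :: "(nat \<Rightarrow> real) \<Rightarrow> 'u" where
  "weight_vec a = vec (\<lambda>e. \<Sum>i\<in>e. a i)"

text \<open>The inverse of \<open>weight_vec\<close> on vertex weights of sum zero, by
  \<open>sum_incident_edges\<close>.\<close>

definition vertex :: "nat \<Rightarrow> 'u \<Rightarrow> real" where
  "vertex i x = (\<Sum>f\<in>{f \<in> edges n. i \<in> f}. c f x) / (real n - 2)"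

lemma Y_iff:
  "x \<in> Y \<longleftrightarrow> x \<in> span (b ` edges n) \<and>
    (\<forall>e\<in>edges n. (\<Sum>f\<in>edges n. real (card (e \<inter> f)) * c f x) = (real n - 2) * c e x)"
proof -
  have "(\<Sum>f\<in>edges n. (real (card (e \<inter> f)) - (if e = f then real n - 2 else 0)) * c f x)
    = (\<Sum>f\<in>edges n. real (card (e \<inter> f)) * c f x) - (real n - 2) * c e x"
    if "e \<in> edges n" for e
    using that finite_edges
    by (simp add: left_diff_distrib sum_subtractf if_distrib[of "\<lambda>r. r * _"] sum.delta cong: if_cong)
  then show ?thesis by (auto simp: Y_def eqn_space_def)
qed

lemma banach_on_Y: "banach_on Y sup_norm"
  unfolding Y_def by (rule banach_on_eqn_space)

lemma weight_vec_in_Y: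
  assumes "(\<Sum>i<n. a i) = 0"
  shows "weight_vec a \<in> Y"
  using assms by (simp add: Y_iff weight_vec_def vec_in_span c_vec sum_card_Int_edge_weights)

text \<open>This is the eigenvalue equation at \<open>e\<close>, regrouped by the two ends of
  \<open>e\<close>.\<close>

lemma c_eq_sum_vertex:
  assumes "x \<in> Y" "e \<in> edges n"
  shows "c e x = (\<Sum>i\<in>e. vertex i x)"
proof -
  have "(real n - 2) * c e x = (\<Sum>i\<in>e. \<Sum>f\<in>{f \<in> edges n. i \<in> f}. c f x)"
    using assms by (simp add: Y_iff sum_card_Int_edges[symmetric])
  then show ?thesis
    using n_ge by (simp add: vertex_def sum_divide_distrib[symmetric] field_simps)
qed

text \<open>Summing the eigenvalue equations over all edges multiplies the total by
  \<open>n - 2\<close>, but the column sums of the symmetric \<open>K\<close> multiply it by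
  \<open>2 n - 2\<close>; the two factors differ by \<open>n\<close>.\<close>

lemma sum_c_eq_0:
  assumes "x \<in> Y"
  shows "(\<Sum>e\<in>edges n. c e x) = 0"
proof -
  have "(real n - 2) * (\<Sum>e\<in>edges n. c e x)
      = (\<Sum>e\<in>edges n. \<Sum>f\<in>edges n. real (card (e \<inter> f)) * c f x)"
    using assms by (simp add: Y_iff sum_distrib_left)
  also have "\<dots> = (\<Sum>f\<in>edges n. (\<Sum>e\<in>edges n. real (card (f \<inter> e))) * c f x)"
    by (subst sum.swap) (simp add: sum_distrib_right Int_commute)
  also have "\<dots> = (2 * real n - 2) * (\<Sum>e\<in>edges n. c e x)"
    by (simp add: sum_card_Int_const sum_distrib_left)
  finally show ?thesis using n_ge by (simp add: algebra_simps)
qed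

lemma sum_vertex_eq_0:
  assumes "x \<in> Y"
  shows "(\<Sum>i<n. vertex i x) = 0"
proof -
  have "(\<Sum>i<n. \<Sum>f\<in>{f \<in> edges n. i \<in> f}. c f x) = (\<Sum>f\<in>edges n. \<Sum>i\<in>{i \<in> {..<n}. i \<in> f}. c f x)"
    using finite_edges by (intro sum.swap_restrict) auto
  also have "\<dots> = (\<Sum>f\<in>edges n. 2 * c f x)"
  proof (intro sum.cong refl)
    fix f assume f: "f \<in> edges n"
    then have "{i \<in> {..<n}. i \<in> f} = f" by (auto simp: edges_def)
    then show "(\<Sum>i\<in>{i \<in> {..<n}. i \<in> f}. c f x) = 2 * c f x"
      using f by (simp add: edges_def)
  qed
  also have "\<dots> = 0" using sum_c_eq_0[OF assms] by (simp add: sum_distrib_left[symmetric])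
  finally show ?thesis by (simp add: vertex_def sum_divide_distrib[symmetric])
qed

lemma vertex_weight_vec:
  assumes "i < n" "(\<Sum>j<n. a j) = 0"
  shows "vertex i (weight_vec a) = a i"
  using assms n_ge by (simp add: vertex_def weight_vec_def c_vec sum_incident_edges)

lemma linear_vertex: "linear (vertex i)"
  by (rule linearI)
    (simp_all add: vertex_def c_simps sum.distrib add_divide_distrib sum_distrib_left)

text \<open>Subtracting the weight at vertex 0 makes the sum zero. The index \<open>k = 0\<close>
  gives the zero vector, so the basis is indexed by \<open>{1..<n}\<close>.\<close>

definition basis_vec :: "nat \<Rightarrow> 'u" where
  "basis_vec k = weight_vec (\<lambda>i. (if i = k then 1 else 0) - (if i = 0 then 1 else 0))"

lemma basis_vec_in_Y: "k < n \<Longrightarrow> basis_vec k \<in> Y"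
  unfolding basis_vec_def using n_ge by (intro weight_vec_in_Y) (simp add: sum_subtractf)

lemma vertex_basis_vec:
  assumes "i \<in> {1..<n}" "k \<in> {1..<n}"
  shows "vertex i (basis_vec k) = (if i = k then 1 else 0)"
proof -
  have "vertex i (basis_vec k) = (if i = k then 1 else 0) - (if i = 0 then 1 else 0)"
    unfolding basis_vec_def using assms n_ge by (intro vertex_weight_vec) (auto simp: sum_subtractf)
  then show ?thesis using assms by simp
qed

lemma span_basis_vec: "span (basis_vec ` {1..<n}) = Y"
proof
  show "span (basis_vec ` {1..<n}) \<subseteq> Y"
    using basis_vec_in_Y by (intro span_minimal) (auto simp: Y_def subspace_eqn_space)
  show "Y \<subseteq> span (basis_vec ` {1..<n})"
  proof
    fix x assume x: "x \<in> Y"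
    let ?z = "\<Sum>k\<in>{1..<n}. vertex k x *\<^sub>R basis_vec k"
    \<comment> \<open>The basis omits vertex 0, whose weight is determined by the others.\<close>
    have z0: "vertex 0 x = - (\<Sum>k\<in>{1..<n}. vertex k x)"
      using sum_vertex_eq_0[OF x] n_ge
      by (simp add: lessThan_atLeast0 sum.atLeast_Suc_lessThan)
    have "x = ?z"
    proof (rule span_eqI)
      show "x \<in> span (b ` edges n)" using x by (simp add: Y_iff)
      show "?z \<in> span (b ` edges n)"
        by (intro span_sum span_scale) (use basis_vec_in_Y in \<open>auto simp: Y_iff\<close>)
      fix e assume e: "e \<in> edges n"
      have "c e ?z = (\<Sum>k\<in>{1..<n}. \<Sum>i\<in>e. vertex k x *
          ((if i = k then 1 else 0) - (if i = 0 then 1 else 0)))"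
        using e by (simp add: c_simps basis_vec_def weight_vec_def c_vec sum_distrib_left)
      also have "\<dots> = (\<Sum>i\<in>e. \<Sum>k\<in>{1..<n}. vertex k x *
          ((if i = k then 1 else 0) - (if i = 0 then 1 else 0)))"
        by (rule sum.swap)
      also have "\<dots> = (\<Sum>i\<in>e. vertex i x)"
      proof (rule sum.cong[OF refl])
        fix i assume "i \<in> e"
        then have i: "i < n" using e by (auto simp: edges_def)
        show "(\<Sum>k\<in>{1..<n}. vertex k x * ((if i = k then 1 else 0) - (if i = 0 then 1 else 0)))
          = vertex i x"
        proof (cases "i = 0")
          case True
          then have "(\<Sum>k\<in>{1..<n}. vertex k x * ((if i = k then 1 else 0) - (if i = 0 then 1 else 0)))
            = (\<Sum>k\<in>{1..<n}. - vertex k x)" by (intro sum.cong) auto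
          then show ?thesis using True z0 by (simp add: sum_negf)
        next
          case False
          then show ?thesis using i
            by (simp add: if_distrib[of "\<lambda>r. _ * r"] sum.delta' cong: if_cong)
        qed
      qed
      finally show "c e x = c e ?z" using c_eq_sum_vertex[OF x e] by simp
    qed
    then show "x \<in> span (basis_vec ` {1..<n})"
      by (metis (no_types, lifting) imageI span_base span_scale span_sum)
  qed
qed

lemma dim_Y: "dim Y = n - 1"
proof -
  have "inj_on basis_vec {1..<n}" "independent (basis_vec ` {1..<n})"
    by (rule dual_family_independent[of "{1..<n}" vertex basis_vec];
      simp add: linear_vertex vertex_basis_vec)+
  then show ?thesis
    by (simp add: span_basis_vec[symmetric] dim_span dim_eq_card_independent card_image)
qed

section \<open>The trace estimate for projections onto \<open>Y\<close>\<close>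

lemma onorm_on_ge:
  assumes P: "P \<in> projections_onto (span (b ` edges n)) sup_norm Y"
  shows "4 * (real n - 3) / real n \<le> onorm_on (span (b ` edges n)) sup_norm P"
proof -
  let ?E = "edges n" and ?L = "onorm_on (span (b ` edges n)) sup_norm P"
  let ?K = "\<lambda>e f. real (card (e \<inter> f :: nat set))"
  let ?S = "\<lambda>e f. 2 * ?K e f - 1 - (if e = f then 2 else 0)"
  \<comment> \<open>The matrix of \<open>P\<close>, with row \<open>f\<close> and column
    \<open>e\<close>; its columns lie in \<open>Y\<close>, so \<open>K\<close> scales them by
    \<open>n - 2\<close> and their sums vanish.\<close>
  define p where "p f e = c f (P (b e))" for f e
  have lin: "bounded_linear_on (span (b ` ?E)) sup_norm P"
    and fix_Y: "\<And>y. y \<in> Y \<Longrightarrow> P y = y"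
    and into: "\<And>e. e \<in> ?E \<Longrightarrow> P (b e) \<in> Y"
    using P by (auto simp: projections_onto_def image_subset_iff span_base)
  have N: "card ?E > 0" using finite_edges edges_nonempty n_ge by (simp add: card_gt_0_iff)
  have eigen: "(\<Sum>f\<in>?E. ?K e f * p f e) = (real n - 2) * p e e" if "e \<in> ?E" for e
    using into[OF that] that by (simp add: Y_iff p_def)
  have zero: "(\<Sum>f\<in>?E. p f e) = 0" if "e \<in> ?E" for e
    unfolding p_def using sum_c_eq_0[OF into[OF that]] .
  text \<open>The vectors \<open>weight_vec a\<close> here are \<open>n - 2\<close> times the columns of the orthogonal projection
    onto \<open>Y\<close>, whose trace every projection onto \<open>Y\<close> shares.\<close>
  have diag: "(\<Sum>e\<in>?E. (?K e f - 4 / n) * p f e) = 2 - 4 / n" if f: "f \<in> ?E" for f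
  proof -
    define a where "a i = (if i \<in> f then 1 else 0) - 2 / real n" for i
    have f': "f \<subseteq> {..<n}" "card f = 2" using f by (auto simp: edges_def)
    then have "{..<n} \<inter> f = f" by auto
    then have "(\<Sum>i<n. a i) = 0"
      using f' n_ge by (simp add: a_def sum_subtractf sum.If_cases)
    then have Pw: "P (weight_vec a) = weight_vec a" by (intro fix_Y weight_vec_in_Y)
    have a: "(\<Sum>i\<in>e. a i) = ?K e f - 4 / n" if "e \<in> ?E" for e
      using that finite_edge[OF that]
      by (simp add: a_def sum_subtractf sum.If_cases edges_def Int_def)
    have "(\<Sum>e\<in>?E. (?K e f - 4 / n) * p f e) = c f (P (weight_vec a))"
      using f by (simp add: weight_vec_def bounded_linear_on_vec[OF lin] c_simps p_def a)
    also have "\<dots> = 2 - 4 / n"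
      unfolding Pw using f f' by (simp add: weight_vec_def c_vec a)
    finally show ?thesis .
  qed
  have sum_p: "(\<Sum>f\<in>?E. \<Sum>e\<in>?E. p f e) = 0"
    by (subst sum.swap) (simp add: zero)
  \<comment> \<open>The trace of \<open>K P\<close> is computed twice: from \<open>diag\<close>,
    where the constant \<open>4 / n\<close> meets the vanishing total of all entries, and from
    \<open>eigen\<close>, as \<open>n - 2\<close> times the trace of \<open>P\<close>.\<close>
  have "card ?E * (2 - 4 / n) = (\<Sum>f\<in>?E. \<Sum>e\<in>?E. (?K e f - 4 / n) * p f e)"
    by (simp add: diag)
  also have "\<dots> = (\<Sum>f\<in>?E. \<Sum>e\<in>?E. ?K e f * p f e) - 4 / n * (\<Sum>f\<in>?E. \<Sum>e\<in>?E. p f e)"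
    by (simp add: left_diff_distrib sum_subtractf sum_distrib_left)
  finally have sum_K: "(\<Sum>f\<in>?E. \<Sum>e\<in>?E. ?K e f * p f e) = card ?E * (2 - 4 / n)"
    using sum_p by simp
  also have "(\<Sum>f\<in>?E. \<Sum>e\<in>?E. ?K e f * p f e) = (real n - 2) * (\<Sum>e\<in>?E. p e e)"
    by (subst sum.swap) (simp add: eigen sum_distrib_left)
  also have "card ?E * (2 - 4 / n) = (real n - 2) * (card ?E * 2 / n)"
    using n_ge by (simp add: field_simps)
  \<comment> \<open>This value is \<open>n - 1\<close>; in the form with \<open>card ?E\<close> that
    factor cancels at the end.\<close>
  finally have tr: "(\<Sum>e\<in>?E. p e e) = card ?E * 2 / n"
    using n_ge by (subst (asm) mult_cancel_left) simp
  \<comment> \<open>The term \<open>2 I\<close> of the sign matrix picks out the diagonal; the term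
    \<open>J\<close> contributes the vanishing total \<open>sum_p\<close>.\<close>
  have "(\<Sum>e\<in>?E. (if e = f then 2 else 0) * p f e) = 2 * p f f" if "f \<in> ?E" for f
    using that finite_edges by (simp add: if_distrib[of "\<lambda>r. r * _"] sum.delta cong: if_cong)
  then have "(\<Sum>f\<in>?E. \<Sum>e\<in>?E. ?S e f * p f e)
    = 2 * (\<Sum>f\<in>?E. \<Sum>e\<in>?E. ?K e f * p f e) - (\<Sum>f\<in>?E. \<Sum>e\<in>?E. p f e) - 2 * (\<Sum>e\<in>?E. p e e)"
    by (simp add: left_diff_distrib sum_subtractf sum_distrib_left mult.assoc)
  also have "\<dots> = card ?E * (4 * (real n - 3) / n)"
    unfolding sum_K sum_p tr using n_ge by (simp add: field_simps)
  finally have "card ?E * (4 * (real n - 3) / n) = (\<Sum>f\<in>?E. \<Sum>e\<in>?E. ?S e f * p f e)" ..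
  also have "\<dots> \<le> card ?E * ?L"
    unfolding p_def
  proof (rule trace_le_onorm[OF lin])
    fix e f assume e: "e \<in> ?E" and f: "f \<in> ?E"
    \<comment> \<open>Equal edges give \<open>4 - 1 - 2 = 1\<close>; distinct edges share at most
      one vertex, which gives 1 or -1.\<close>
    show "\<bar>?S e f\<bar> \<le> 1"
    proof (cases "e = f")
      case True
      then show ?thesis using f by (simp add: edges_def)
    next
      case False
      have "e \<inter> f \<subset> e"
      proof (rule psubsetI)
        show "e \<inter> f \<noteq> e"
          using False e f card_seteq[of f e] finite_edge[OF f] by (auto simp: edges_def)
      qed auto
      then have "card (e \<inter> f) < 2"
        using psubset_card_mono[OF finite_edge[OF e]] e by (auto simp: edges_def)
      then show ?thesis using False by auto
    qed
  qed
  finally show ?thesis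
    by (rule mult_left_le_imp_le) (use N in simp)
qed

lemma abs_proj_const_Y_ge: "ereal (4 * (real n - 3) / real n) \<le> abs_proj_const Y sup_norm"
proof -
  let ?X = "span (b ` edges n)"
  have "ereal (4 * (real n - 3) / real n) \<le> rel_proj_const Y ?X sup_norm"
    unfolding rel_proj_const_def using onorm_on_ge by (intro INF_greatest) simp
  also have "\<dots> \<le> abs_proj_const Y sup_norm"
    unfolding abs_proj_const_def
    by (rule SUP_upper2[of "(?X, sup_norm)"]) (auto simp: banach_on_span Y_iff)
  finally show ?thesis .
qed

end

theorem corollary2p1:
  fixes m :: nat
  assumes universe: "\<exists>B :: 'u::real_vector set. infinite B \<and> independent B"
    and m: "m \<ge> 3"
  shows "max_abs_proj_const TYPE('u) m \<ge> ereal (4 * (real m - 2) / (real m + 1))"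
proof -
  obtain B :: "'u set" where "infinite B" "independent B" using universe by blast
  then obtain b :: "nat set \<Rightarrow> 'u" and c where "biorthogonal (edges (m + 1)) b c"
    using exists_biorthogonal[of B "edges (m + 1)"] finite_edges edges_nonempty[of "m + 1"] m by auto
  then interpret edge_space "m + 1" b c
    using m by (simp add: edge_space_def edge_space_axioms_def)
  \<comment> \<open>With \<open>n = m + 1\<close> the bound \<open>4 (n - 3) / n\<close> takes this
    form, and \<open>Y\<close> has dimension \<open>n - 1 = m\<close>.\<close>
  have "ereal (4 * (real m - 2) / (real m + 1)) \<le> abs_proj_const Y sup_norm"
    using abs_proj_const_Y_ge by (simp add: algebra_simps)
  also have "\<dots> \<le> max_abs_proj_const TYPE('u) m"
    unfolding max_abs_proj_const_def
  proof (rule SUP_upper2[of "(Y, sup_norm)"])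
    have "\<exists>B. finite B \<and> span B = Y" using span_basis_vec by blast
    then show "(Y, sup_norm) \<in> {(Y, M). banach_on Y M \<and> (\<exists>B. finite B \<and> span B = Y) \<and> dim Y = m}"
      using dim_Y banach_on_Y by simp
  qed simp
  finally show ?thesis .
qed

end
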